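(* Let $\mathbf{X}=\{X_1,\dots,X_p\}$ and $\mathbf{Y}=\{Y_1,\dots,Y_r\}$ be finite families of irreducible germs of analytic varieties in $(\mathbb{C}^n,0)$, each irredundant (i.e. removing any member of the family changes $\mathbb{D}_{\mathbf{X}}$, resp. $\mathbb{D}_{\mathbf{Y}}$). If $\mathbb{D}_{\mathbf{X}}=\mathbb{D}_{\mathbf{Y}}$, then $\mathbf{X}=\mathbf{Y}$ as sets of germs.
   Context: $\mathcal{O}_n$ denotes the algebra of germs of holomorphic functions $(\mathbb{C}^n,0)\to\mathbb{C}$, and $\mathbb{D}=\operatorname{Der}\mathcal{O}_n$ the Lie algebra of germs of analytic vector fields on $(\mathbb{C}^n,0)$. A "germ of analytic variety" means a reduced (possibly reducible) complex space germ $X\subset(\mathbb{C}^n,0)$; $I_X\subset\mathcal{O}_n$ is the ideal of function germs vanishing on $X$, and $\mathbb{D}_X=\{D\in\mathbb{D}: D(I_X)\subset I_X\}$. For a finite family $\mathbf{X}$ of germs, $\mathbb{D}_{\mathbf{X}}=\bigcap_{X\in\mathbf{X}}\mathbb{D}_X$. *)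

theory Defs
  imports "HOL-Analysis.Analysis"
begin

text \<open>Points of C^n are vectors complex^'n (the finite type 'n indexes the coordinates).
Germs at 0 are handled through representatives together with the filter nhds 0.\<close>

definition cdiff_at :: "(complex^'n \<Rightarrow> complex) \<Rightarrow> complex^'n \<Rightarrow> bool" where
  "cdiff_at f z \<longleftrightarrow> (\<exists>L. (f has_derivative L) (at z) \<and> (\<forall>c v. L (c *s v) = c * L v))"

definition holo_germ :: "(complex^'n \<Rightarrow> complex) \<Rightarrow> bool" where
  "holo_germ f \<longleftrightarrow> (\<forall>\<^sub>F z in nhds 0. cdiff_at f z)"

definition germ_eq :: "(complex^'n) set \<Rightarrow> (complex^'n) set \<Rightarrow> bool" where
  "germ_eq A B \<longleftrightarrow> (\<forall>\<^sub>F z in nhds 0. z \<in> A \<longleftrightarrow> z \<in> B)"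

definition analytic_germ :: "(complex^'n) set \<Rightarrow> bool" where
  "analytic_germ S \<longleftrightarrow> (\<exists>F. finite F \<and> (\<forall>f\<in>F. holo_germ f) \<and>
      (\<forall>\<^sub>F z in nhds 0. z \<in> S \<longleftrightarrow> (\<forall>f\<in>F. f z = 0)))"

definition irreducible_germ :: "(complex^'n) set \<Rightarrow> bool" where
  "irreducible_germ X \<longleftrightarrow> analytic_germ X \<and> \<not> germ_eq X {} \<and>
     (\<forall>A B. analytic_germ A \<and> analytic_germ B \<and> germ_eq X (A \<union> B) \<longrightarrow>
        germ_eq X A \<or> germ_eq X B)"

definition vanishing_ideal :: "(complex^'n) set \<Rightarrow> (complex^'n \<Rightarrow> complex) set" where
  "vanishing_ideal X = {f. holo_germ f \<and> (\<forall>\<^sub>F z in nhds 0. z \<in> X \<longrightarrow> f z = 0)}"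

text \<open>Vector fields D = sum_i a_i d/dz_i with holomorphic coefficients (= Der O_n).\<close>
definition vector_field :: "('n \<Rightarrow> complex^'n \<Rightarrow> complex) \<Rightarrow> bool" where
  "vector_field a \<longleftrightarrow> (\<forall>i. holo_germ (a i))"

definition apply_vf :: "('n::finite \<Rightarrow> complex^'n \<Rightarrow> complex) \<Rightarrow> (complex^'n \<Rightarrow> complex) \<Rightarrow> complex^'n \<Rightarrow> complex" where
  "apply_vf a f = (\<lambda>z. \<Sum>i\<in>UNIV. a i z * frechet_derivative f (at z) (axis i 1))"

definition logder :: "(complex^'n::finite) set \<Rightarrow> ('n \<Rightarrow> complex^'n \<Rightarrow> complex) set" where
  "logder X = {a. vector_field a \<and> (\<forall>f\<in>vanishing_ideal X. apply_vf a f \<in> vanishing_ideal X)}"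

definition logder_fam :: "(complex^'n::finite) set set \<Rightarrow> ('n \<Rightarrow> complex^'n \<Rightarrow> complex) set" where
  "logder_fam XX = {a. vector_field a \<and> (\<forall>X\<in>XX. a \<in> logder X)}"

definition irredundant :: "(complex^'n::finite) set set \<Rightarrow> bool" where
  "irredundant XX \<longleftrightarrow> (\<forall>X\<in>XX. logder_fam (XX - {X}) \<noteq> logder_fam XX)"

end

theory Submission
  imports Defs "HOL-Complex_Analysis.Complex_Analysis"
begin

text \<open>Among the members of the two families without a partner in the other family, choose one, Z, that
is maximal for inclusion of germs, say in YY. By maximality, the members of XX containing Z have partners in
YY - {Z}. For every other X in XX there is a function vanishing on X but not on Z; as Z is irreducible, the
product f of these functions does not vanish on Z. If a vector field a preserves the ideals of YY - {Z}, then
f a preserves the ideals of XX, hence that of Z, and the primality of that ideal allows f to be cancelled.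
So Z is redundant in YY.

The cancellation needs derivatives of holomorphic functions to be holomorphic in the sense of Frechet
differentiability; this holds because difference quotients converge uniformly.\<close>

section \<open>Partial derivatives of holomorphic germs\<close>

lemma norm_vector_scalar_mult:
  fixes v :: "complex^'n::finite"
  shows "norm (c *s v) = norm c * norm v"
  by (simp add: norm_vec_def norm_mult L2_set_right_distrib)

lemma bounded_linear_vector_scalar_mult_left:
  fixes v :: "complex^'n::finite"
  shows "bounded_linear (\<lambda>c. c *s v)"
  by (rule bounded_linear_intro[of _ "norm v"])
     (auto simp: norm_vector_scalar_mult vector_sadd_rdistrib vec_eq_iff)

lemma cdiff_at_frechet_derivative:
  fixes f :: "complex^'n::finite \<Rightarrow> complex"
  assumes "cdiff_at f z"
  shows "(f has_derivative frechet_derivative f (at z)) (at z)"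
    and "frechet_derivative f (at z) (c *s v) = c * frechet_derivative f (at z) v"
proof -
  obtain L where L: "(f has_derivative L) (at z)" "\<And>c v. L (c *s v) = c * L v"
    using assms unfolding cdiff_at_def by auto
  moreover have "frechet_derivative f (at z) = L"
    using L(1) by (metis frechet_derivative_at)
  ultimately show "(f has_derivative frechet_derivative f (at z)) (at z)"
    "frechet_derivative f (at z) (c *s v) = c * frechet_derivative f (at z) v" by auto
qed

lemma cdiff_at_continuous: "cdiff_at f z \<Longrightarrow> isCont f z"
  using cdiff_at_frechet_derivative(1) has_derivative_continuous by blast

text \<open>The chain rule, where complex homogeneity of the Frechet derivative turns the
  real-linear derivative of the restriction into multiplication by a complex number. This opens the
  way to one-variable theory.\<close>

lemma cdiff_at_line:
  fixes f :: "complex^'n::finite \<Rightarrow> complex"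
  assumes "cdiff_at f (z + \<zeta> *s v)"
  shows "((\<lambda>\<zeta>. f (z + \<zeta> *s v)) has_field_derivative
           frechet_derivative f (at (z + \<zeta> *s v)) v) (at \<zeta>)"
proof -
  have "((\<lambda>\<zeta>. z + \<zeta> *s v) has_derivative (\<lambda>c. c *s v)) (at \<zeta>)"
    using bounded_linear_imp_has_derivative[OF bounded_linear_vector_scalar_mult_left[of v]]
      has_derivative_add_const[of "\<lambda>\<zeta>. \<zeta> *s v" _ _ z] by (simp add: add.commute)
  from has_derivative_compose[OF this cdiff_at_frechet_derivative(1)[OF assms]]
  show ?thesis
    unfolding has_field_derivative_def
    by (rule has_derivative_eq_rhs)
       (simp add: cdiff_at_frechet_derivative(2)[OF assms] fun_eq_iff mult.commute)
qed

section \<open>Cauchy estimates along complex lines\<close>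

text \<open>The one-variable Cauchy inequality on the line through \<open>z\<close> in direction
  \<open>v\<close>. The disc of radius \<open>\<rho> / norm v\<close> is the largest whose image
  stays in the ball.\<close>

lemma frechet_derivative_Cauchy_bound:
  fixes f :: "complex^'n::finite \<Rightarrow> complex"
  assumes \<rho>: "\<rho> > 0" and f: "\<And>w. w \<in> cball z \<rho> \<Longrightarrow> cdiff_at f w"
    and B: "\<And>w. w \<in> cball z \<rho> \<Longrightarrow> norm (f w) \<le> B"
  shows "norm (frechet_derivative f (at z) v) \<le> B / \<rho> * norm v"
proof (cases "v = 0")
  case True
  have "cdiff_at f z" using f \<rho> by auto
  from cdiff_at_frechet_derivative(2)[OF this, of 0 0] show ?thesis
    using True by simp
next
  case False
  define s where "s = \<rho> / norm v"
  define \<phi> where "\<phi> = (\<lambda>\<zeta>. f (z + \<zeta> *s v))"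
  have s: "s > 0" using False \<rho> by (simp add: s_def)
  have inball: "z + \<zeta> *s v \<in> cball z \<rho>" if "norm \<zeta> \<le> s" for \<zeta>
    using that False by (simp add: dist_norm norm_vector_scalar_mult s_def field_simps)
  have d: "(\<phi> has_field_derivative frechet_derivative f (at (z + \<zeta> *s v)) v) (at \<zeta>)"
    if "norm \<zeta> \<le> s" for \<zeta>
    unfolding \<phi>_def by (rule cdiff_at_line[OF f[OF inball[OF that]]])
  have "norm ((deriv ^^ 1) \<phi> 0) \<le> fact 1 * B / s ^ 1"
  proof (rule Cauchy_inequality)
    show "\<phi> holomorphic_on ball 0 s"
      using d by (force simp: holomorphic_on_open)
    show "continuous_on (cball 0 s) \<phi>"
      using d by (intro continuous_at_imp_continuous_on) (force intro: DERIV_isCont)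
    show "norm (\<phi> x) \<le> B" if "norm (0 - x) = s" for x
      using B[OF inball] that unfolding \<phi>_def by simp
  qed (fact s)
  moreover have "deriv \<phi> 0 = frechet_derivative f (at z) v"
    using DERIV_imp_deriv[OF d[of 0]] s by simp
  ultimately show ?thesis by (simp add: s_def)
qed

text \<open>First-order Taylor expansion along a line, with the remainder controlled by a Cauchy
  bound on the second derivative. The estimate depends on \<open>z\<close> only through
  \<open>B\<close> and \<open>\<rho>\<close>, hence is uniform wherever these can be chosen
  uniformly.\<close>

lemma difference_quotient_bound:
  fixes f :: "complex^'n::finite \<Rightarrow> complex"
  assumes \<rho>: "\<rho> > 0" and f: "\<And>w. w \<in> cball z (2 * \<rho>) \<Longrightarrow> cdiff_at f w"
    and B: "\<And>w. w \<in> cball z (2 * \<rho>) \<Longrightarrow> norm (f w) \<le> B"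
    and e: "norm e = 1" and t: "t \<noteq> 0" "norm t \<le> \<rho>"
  shows "norm ((f (z + t *s e) - f z) / t - frechet_derivative f (at z) e) \<le> 2 * B / \<rho>\<^sup>2 * norm t"
proof -
  define \<phi> where "\<phi> = (\<lambda>\<zeta>. f (z + \<zeta> *s e))"
  have inball: "z + \<zeta> *s e \<in> cball z (2 * \<rho>)" if "norm \<zeta> \<le> 2 * \<rho>" for \<zeta>
    using that e by (simp add: dist_norm norm_vector_scalar_mult)
  have d: "(\<phi> has_field_derivative frechet_derivative f (at (z + \<zeta> *s e)) e) (at \<zeta>)"
    if "norm \<zeta> \<le> 2 * \<rho>" for \<zeta>
    unfolding \<phi>_def by (rule cdiff_at_line[OF f[OF inball[OF that]]])
  have hol: "\<phi> holomorphic_on ball 0 (2 * \<rho>)"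
    using d by (force simp: holomorphic_on_open)
  have cont: "continuous_on (cball 0 (2 * \<rho>)) \<phi>"
    using d by (intro continuous_at_imp_continuous_on) (force intro: DERIV_isCont)
  \<comment> \<open>The remainder bound used here divides by \<open>fact 1\<close> and not by 2, so
    the factor 2 of the second-order Cauchy inequality survives in the constant.\<close>
  have "norm ((deriv ^^ 0) \<phi> t - (\<Sum>i\<le>1. (deriv ^^ i) \<phi> 0 * (t - 0) ^ i / fact i))
        \<le> 2 * B / \<rho>\<^sup>2 * norm (t - 0) ^ Suc 1 / fact 1"
  proof (rule complex_Taylor)
    show "((deriv ^^ i) \<phi> has_field_derivative (deriv ^^ Suc i) \<phi> x) (at x within cball 0 \<rho>)"
      if "x \<in> cball 0 \<rho>" for i x
    proof -
      have "(deriv ^^ i) \<phi> holomorphic_on ball 0 (2 * \<rho>)"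
        by (rule holomorphic_higher_deriv[OF hol]) auto
      moreover have "x \<in> ball 0 (2 * \<rho>)" using that \<rho> by auto
      ultimately show ?thesis
        using holomorphic_derivI[of _ "ball 0 (2 * \<rho>)"] by (auto intro: DERIV_subset)
    qed
    show "norm ((deriv ^^ Suc 1) \<phi> x) \<le> 2 * B / \<rho>\<^sup>2" if "x \<in> cball 0 \<rho>" for x
    proof -
      \<comment> \<open>A disc of radius \<open>\<rho>\<close> around a point of the disc of radius
        \<open>\<rho>\<close> stays where \<open>f\<close> is bounded by \<open>B\<close>; this is
        why the hypotheses use \<open>2 * \<rho>\<close>.\<close>
      have sub: "cball x \<rho> \<subseteq> cball 0 (2 * \<rho>)" "ball x \<rho> \<subseteq> ball 0 (2 * \<rho>)"
        using that by (auto simp: subset_iff dist_norm) (smt (verit) norm_triangle_sub norm_minus_commute)+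
      have "norm ((deriv ^^ 2) \<phi> x) \<le> fact 2 * B / \<rho> ^ 2"
      proof (rule Cauchy_inequality)
        show "norm (\<phi> y) \<le> B" if "norm (x - y) = \<rho>" for y
        proof -
          have "y \<in> cball x \<rho>" using that by (simp add: dist_norm)
          then have "norm y \<le> 2 * \<rho>" using sub(1) by (auto simp: dist_norm)
          then show ?thesis using B[OF inball] unfolding \<phi>_def by simp
        qed
      qed (use sub hol cont \<rho> holomorphic_on_subset continuous_on_subset in blast)+
      then show ?thesis by (simp add: numeral_2_eq_2)
    qed
  qed (use t \<rho> in auto)
  moreover have "deriv \<phi> 0 = frechet_derivative f (at z) e"
    using DERIV_imp_deriv[OF d[of 0]] \<rho> by simp
  ultimately have "norm (f (z + t *s e) - f z - t * frechet_derivative f (at z) e)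
      \<le> 2 * B / \<rho>\<^sup>2 * (norm t * norm t)"
    by (simp add: \<phi>_def algebra_simps)
  moreover have "(f (z + t *s e) - f z) / t - frechet_derivative f (at z) e
      = (f (z + t *s e) - f z - t * frechet_derivative f (at z) e) / t"
    using t by (simp add: field_simps)
  ultimately show ?thesis
    using t by (simp add: norm_divide field_simps)
qed

section \<open>Closure properties of complex differentiability\<close>

lemma cdiff_at_diff:
  fixes f g :: "complex^'n::finite \<Rightarrow> complex"
  assumes "cdiff_at f z" "cdiff_at g z"
  shows "cdiff_at (\<lambda>w. f w - g w) z"
    and "frechet_derivative (\<lambda>w. f w - g w) (at z)
       = (\<lambda>v. frechet_derivative f (at z) v - frechet_derivative g (at z) v)"
proof -
  have d: "((\<lambda>w. f w - g w) has_derivative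
      (\<lambda>v. frechet_derivative f (at z) v - frechet_derivative g (at z) v)) (at z)"
    using assms by (intro has_derivative_diff cdiff_at_frechet_derivative(1))
  then show "cdiff_at (\<lambda>w. f w - g w) z"
    unfolding cdiff_at_def
    by (rule_tac exI, rule_tac conjI, assumption)
       (simp add: assms[THEN cdiff_at_frechet_derivative(2)] right_diff_distrib)
  show "frechet_derivative (\<lambda>w. f w - g w) (at z)
       = (\<lambda>v. frechet_derivative f (at z) v - frechet_derivative g (at z) v)"
    using frechet_derivative_at[OF d] by simp
qed

lemma cdiff_at_const: "cdiff_at (\<lambda>_. c) z"
  unfolding cdiff_at_def by (rule exI[of _ "\<lambda>_. 0"]) auto

lemma cdiff_at_add:
  assumes "cdiff_at f z" "cdiff_at g z"
  shows "cdiff_at (\<lambda>w. f w + g w) z"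
proof -
  obtain L M where L: "(f has_derivative L) (at z)" "\<And>c v. L (c *s v) = c * L v"
    and M: "(g has_derivative M) (at z)" "\<And>c v. M (c *s v) = c * M v"
    using assms unfolding cdiff_at_def by auto
  have "((\<lambda>w. f w + g w) has_derivative (\<lambda>h. L h + M h)) (at z)"
    by (rule has_derivative_add[OF L(1) M(1)])
  then show ?thesis
    unfolding cdiff_at_def by (rule_tac exI, rule_tac conjI, assumption)
      (simp add: L(2) M(2) algebra_simps)
qed

lemma cdiff_at_mult:
  assumes "cdiff_at f z" "cdiff_at g z"
  shows "cdiff_at (\<lambda>w. f w * g w) z"
proof -
  obtain L M where L: "(f has_derivative L) (at z)" "\<And>c v. L (c *s v) = c * L v"
    and M: "(g has_derivative M) (at z)" "\<And>c v. M (c *s v) = c * M v"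
    using assms unfolding cdiff_at_def by auto
  have "((\<lambda>w. f w * g w) has_derivative (\<lambda>h. f z * M h + L h * g z)) (at z)"
    by (rule has_derivative_mult[OF L(1) M(1)])
  then show ?thesis
    unfolding cdiff_at_def by (rule_tac exI, rule_tac conjI, assumption)
      (simp add: L(2) M(2) algebra_simps)
qed

lemma cdiff_at_shift:
  fixes f :: "complex^'n::finite \<Rightarrow> complex"
  assumes "cdiff_at f (z + u)"
  shows "cdiff_at (\<lambda>z. f (z + u)) z"
proof -
  have "((\<lambda>z. z + u) has_derivative (\<lambda>v. v)) (at z)"
    by (auto intro!: derivative_eq_intros)
  from has_derivative_compose[OF this cdiff_at_frechet_derivative(1)[OF assms]]
  show ?thesis
    unfolding cdiff_at_def
    by (rule_tac exI, rule_tac conjI, assumption)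
       (simp add: cdiff_at_frechet_derivative(2)[OF assms])
qed

section \<open>Uniform limits and holomorphy of partial derivatives\<close>

text \<open>The Cauchy bound for \<open>q k - q l\<close> turns uniform convergence on the larger
  ball into uniform convergence of the derivatives on the smaller one, so limit and derivative may
  be interchanged. Complex homogeneity passes to the pointwise limit of the derivatives.\<close>

lemma cdiff_at_uniform_limit:
  fixes q :: "nat \<Rightarrow> complex^'n::finite \<Rightarrow> complex"
  assumes r: "r > 0" and q: "\<And>k z. z \<in> cball x (2 * r) \<Longrightarrow> cdiff_at (q k) z"
    and lim: "\<And>k z. z \<in> cball x (2 * r) \<Longrightarrow> norm (q k z - h z) \<le> \<epsilon> k"
    and \<epsilon>: "\<epsilon> \<longlonglongrightarrow> 0" and z: "z \<in> ball x r"
  shows "cdiff_at h z"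
proof -
  define F where "F k z = frechet_derivative (q k) (at z)" for k z
  define G where "G z v = lim (\<lambda>k. F k z v)" for z v
  have F_bound: "norm (F k z v - F l z v) \<le> (\<epsilon> k + \<epsilon> l) / r * norm v" if "z \<in> ball x r" for k l z v
  proof -
    have sub: "w \<in> cball x (2 * r)" if "w \<in> cball z r" for w
      using that \<open>z \<in> ball x r\<close> dist_triangle[of x w z] by auto
    have "norm (frechet_derivative (\<lambda>w. q k w - q l w) (at z) v) \<le> (\<epsilon> k + \<epsilon> l) / r * norm v"
    proof (rule frechet_derivative_Cauchy_bound[OF r])
      fix w assume "w \<in> cball z r"
      note w = sub[OF this]
      show "cdiff_at (\<lambda>w. q k w - q l w) w"
        by (intro cdiff_at_diff q w)
      show "norm (q k w - q l w) \<le> \<epsilon> k + \<epsilon> l"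
        using lim[OF w, of k] lim[OF w, of l] norm_triangle_ineq4[of "q k w - h w" "q l w - h w"]
        by simp
    qed
    moreover have "z \<in> cball x (2 * r)" using r by (intro sub) auto
    ultimately show ?thesis
      using cdiff_at_diff(2)[OF q q, of z k l] by (simp add: F_def)
  qed
  have G_lim: "(\<lambda>k. F k z v) \<longlonglongrightarrow> G z v" if "z \<in> ball x r" for z v
  proof -
    have "Cauchy (\<lambda>k. F k z v)"
    proof (rule CauchyI)
      fix e :: real assume e: "e > 0"
      have "(\<lambda>k. \<epsilon> k / r * norm v) \<longlonglongrightarrow> 0 / r * norm v"
        by (intro tendsto_intros \<epsilon>) (use r in auto)
      then have "\<forall>\<^sub>F k in sequentially. \<epsilon> k / r * norm v < e / 2"
        using e by (intro order_tendstoD(2)) auto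
      then obtain N where N: "\<And>k. k \<ge> N \<Longrightarrow> \<epsilon> k / r * norm v < e / 2"
        by (auto simp: eventually_sequentially)
      have "norm (F m z v - F n z v) < e" if "m \<ge> N" "n \<ge> N" for m n
      proof -
        have "norm (F m z v - F n z v) \<le> \<epsilon> m / r * norm v + \<epsilon> n / r * norm v"
          using F_bound[OF \<open>z \<in> ball x r\<close>, of m v n]
          by (simp add: add_divide_distrib distrib_right)
        also have "\<dots> < e / 2 + e / 2"
          by (intro add_strict_mono N that)
        finally show ?thesis by simp
      qed
      then show "\<exists>M. \<forall>m\<ge>M. \<forall>n\<ge>M. norm (F m z v - F n z v) < e" by blast
    qed
    then show ?thesis
      unfolding G_def by (simp add: Cauchy_convergent_iff convergent_LIMSEQ_iff)
  qed
  \<comment> \<open>Let \<open>l\<close> tend to infinity in \<open>F_bound\<close> with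
    \<open>k\<close> fixed.\<close>
  have G_bound: "norm (F k z v - G z v) \<le> \<epsilon> k / r * norm v" if "z \<in> ball x r" for k z v
  proof (rule LIMSEQ_le)
    show "(\<lambda>l. norm (F k z v - F l z v)) \<longlonglongrightarrow> norm (F k z v - G z v)"
      by (intro tendsto_intros G_lim that)
    have "(\<lambda>l. (\<epsilon> k + \<epsilon> l) / r * norm v) \<longlonglongrightarrow> (\<epsilon> k + 0) / r * norm v"
      by (intro tendsto_intros \<epsilon>) (use r in auto)
    then show "(\<lambda>l. (\<epsilon> k + \<epsilon> l) / r * norm v) \<longlonglongrightarrow> \<epsilon> k / r * norm v" by simp
  qed (use F_bound[OF that] in blast)
  have q_lim: "(\<lambda>k. q k z) \<longlonglongrightarrow> h z" if "z \<in> ball x r" for z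
  proof (rule LIM_zero_cancel, rule Lim_null_comparison[OF _ \<epsilon>])
    have "z \<in> cball x (2 * r)" using that r by auto
    from lim[OF this] show "\<forall>\<^sub>F k in sequentially. norm (q k z - h z) \<le> \<epsilon> k" by simp
  qed
  have "\<exists>g. \<forall>z\<in>ball x r. (\<lambda>n. q n z) \<longlonglongrightarrow> g z \<and> (g has_derivative G z) (at z within ball x r)"
  proof (rule has_derivative_sequence[of "ball x r" q F G z "h z"])
    show "(q k has_derivative F k z) (at z within ball x r)" if "z \<in> ball x r" for k z
      unfolding F_def using that r
      by (auto intro!: has_derivative_at_withinI[OF cdiff_at_frechet_derivative(1)[OF q]])
    show "\<forall>\<^sub>F k in sequentially. \<forall>z\<in>ball x r. \<forall>v. norm (F k z v - G z v) \<le> e * norm v"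
      if "e > 0" for e
    proof -
      have "\<forall>\<^sub>F k in sequentially. \<epsilon> k < e * r"
        using order_tendstoD(2)[OF \<epsilon>, of "e * r"] that r by simp
      then show ?thesis
      proof eventually_elim
        case (elim k)
        then have "\<epsilon> k / r * norm v \<le> e * norm v" for v :: "complex^'n"
          using r by (intro mult_right_mono) (auto simp: field_simps)
        then show ?case using G_bound order_trans by blast
      qed
    qed
  qed (use z q_lim[OF z] in simp_all)
  then obtain g where g: "\<And>z. z \<in> ball x r \<Longrightarrow> (\<lambda>n. q n z) \<longlonglongrightarrow> g z"
    "\<And>z. z \<in> ball x r \<Longrightarrow> (g has_derivative G z) (at z within ball x r)" by blast
  \<comment> \<open>Differentiating the sequence yields only some limit function \<open>g\<close>;
    uniqueness of limits identifies it with \<open>h\<close> on the ball.\<close>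
  have "h w = g w" if "w \<in> ball x r" for w
    using LIMSEQ_unique[OF q_lim g(1)] that by blast
  then have "(h has_derivative G z) (at z within ball x r)"
    by (intro has_derivative_transform[OF z _ g(2)[OF z]])
  then have "(h has_derivative G z) (at z)"
    using at_within_open[OF z open_ball] by simp
  moreover have "G z (c *s v) = c * G z v" for c v
  proof (rule LIMSEQ_unique[OF G_lim[OF z]])
    have "z \<in> cball x (2 * r)" using z r by auto
    then have "(\<lambda>k. F k z (c *s v)) = (\<lambda>k. c * F k z v)"
      unfolding F_def by (intro ext cdiff_at_frechet_derivative(2) q)
    then show "(\<lambda>k. F k z (c *s v)) \<longlonglongrightarrow> c * G z v"
      by (simp add: tendsto_mult_left G_lim[OF z])
  qed
  ultimately show ?thesis unfolding cdiff_at_def by blast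
qed

text \<open>The directional derivative is a uniform limit of difference quotients, each of which is
  complex differentiable.\<close>

lemma cdiff_at_frechet_derivative_direction:
  fixes f :: "complex^'n::finite \<Rightarrow> complex"
  assumes R: "R > 0" and f: "\<And>w. w \<in> ball x R \<Longrightarrow> cdiff_at f w" and e: "norm e = 1"
    and z: "z \<in> ball x (R / 8)"
  shows "cdiff_at (\<lambda>w. frechet_derivative f (at w) e) z"
proof -
  \<comment> \<open>The uniform limit needs the quotients on radius \<open>2 * r\<close>, and
    bounding each quotient needs \<open>f\<close> on a further \<open>2 * r\<close>. The closed ball
    of radius \<open>4 * r = R / 2\<close> lies in the domain and is compact, so \<open>f\<close> is
    bounded there.\<close>
  define r where "r = R / 8"
  have r: "r > 0" using R by (simp add: r_def)
  have f': "cdiff_at f w" if "w \<in> cball x (4 * r)" for w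
    using that R by (intro f) (auto simp: r_def)
  have "compact (f ` cball x (4 * r))"
    by (intro compact_continuous_image continuous_at_imp_continuous_on ballI cdiff_at_continuous f' compact_cball)
  then obtain B where B: "\<And>w. w \<in> cball x (4 * r) \<Longrightarrow> norm (f w) \<le> B"
    using compact_imp_bounded[of "f ` cball x (4 * r)"] by (force simp: bounded_iff)
  \<comment> \<open>Nonzero increments tending to 0 and never longer than \<open>r\<close>, as
    \<open>difference_quotient_bound\<close> requires.\<close>
  define t :: "nat \<Rightarrow> complex" where "t k = of_real (r / real (Suc k))" for k
  have norm_t: "norm (t k) = r / real (Suc k)" for k
    using r by (simp only: t_def norm_of_real) simp
  have t: "t k \<noteq> 0" "norm (t k) \<le> r" for k
  proof -
    have "norm (t k) > 0" using r by (simp add: norm_t)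
    then show "t k \<noteq> 0" by simp
    show "norm (t k) \<le> r" using r by (simp add: norm_t field_simps)
  qed
  show ?thesis
  proof (rule cdiff_at_uniform_limit[where x = x and r = r
        and q = "\<lambda>k w. (1 / t k) * (f (w + t k *s e) - f w)"
        and \<epsilon> = "\<lambda>k. 2 * B / r\<^sup>2 * (r / real (Suc k))"])
    fix k w assume w: "w \<in> cball x (2 * r)"
    have sub: "u \<in> cball x (4 * r)" if "u \<in> cball w (2 * r)" for u
      using that w dist_triangle[of x u w] by auto
    have "w + t k *s e \<in> cball w (2 * r)"
      using t(2)[of k] e r by (simp add: dist_norm norm_vector_scalar_mult)
    then show "cdiff_at (\<lambda>w. (1 / t k) * (f (w + t k *s e) - f w)) w"
      using r by (intro cdiff_at_mult cdiff_at_const cdiff_at_diff(1) cdiff_at_shift f' sub) auto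
    show "norm ((1 / t k) * (f (w + t k *s e) - f w) - frechet_derivative f (at w) e)
        \<le> 2 * B / r\<^sup>2 * (r / real (Suc k))"
      using difference_quotient_bound[OF r _ _ e t, of w f B k] f'[OF sub] B[OF sub] by (simp add: norm_t)
  next
    have "(\<lambda>k. 2 * B / r\<^sup>2 * r * (1 / real (Suc k))) \<longlonglongrightarrow> 2 * B / r\<^sup>2 * r * 0"
      by (intro tendsto_mult_left LIMSEQ_Suc lim_1_over_n)
    then show "(\<lambda>k. 2 * B / r\<^sup>2 * (r / real (Suc k))) \<longlonglongrightarrow> 0" by simp
    show "z \<in> ball x r" using z by (simp add: r_def)
  qed (fact r)
qed

lemma holo_germ_frechet_derivative:
  fixes f :: "complex^'n::finite \<Rightarrow> complex"
  assumes "holo_germ f" "norm e = 1"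
  shows "holo_germ (\<lambda>z. frechet_derivative f (at z) e)"
proof -
  obtain R where "R > 0" "\<And>w. w \<in> ball 0 R \<Longrightarrow> cdiff_at f w"
    using assms(1) unfolding holo_germ_def eventually_nhds_metric
    by (auto simp: dist_commute)
  then have "\<forall>z\<in>ball 0 (R / 8). cdiff_at (\<lambda>w. frechet_derivative f (at w) e) z"
    using cdiff_at_frechet_derivative_direction assms(2) by blast
  then show ?thesis
    unfolding holo_germ_def using \<open>R > 0\<close>
    by (intro eventually_nhds_metric[THEN iffD2] exI[of _ "R / 8"]) (auto simp: dist_commute)
qed

section \<open>The ring of holomorphic germs and the action of vector fields\<close>

lemma holo_germ_const: "holo_germ (\<lambda>_. c)"
  by (simp add: holo_germ_def cdiff_at_const)

lemma holo_germ_add: "holo_germ f \<Longrightarrow> holo_germ g \<Longrightarrow> holo_germ (\<lambda>z. f z + g z)"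
  unfolding holo_germ_def by (auto elim: eventually_elim2 intro: cdiff_at_add)

lemma holo_germ_mult: "holo_germ f \<Longrightarrow> holo_germ g \<Longrightarrow> holo_germ (\<lambda>z. f z * g z)"
  unfolding holo_germ_def by (auto elim: eventually_elim2 intro: cdiff_at_mult)

lemma holo_germ_sum:
  "(\<And>i. i \<in> A \<Longrightarrow> holo_germ (f i)) \<Longrightarrow> holo_germ (\<lambda>z. \<Sum>i\<in>A. f i z)"
  by (induction A rule: infinite_finite_induct) (auto intro: holo_germ_const holo_germ_add)

text \<open>The purpose of the analysis above: membership in \<open>vanishing_ideal\<close> includes
  holomorphy, so products with \<open>apply_vf a g\<close> can be treated algebraically only once
  this function is known to be holomorphic.\<close>

lemma holo_germ_apply_vf: "vector_field a \<Longrightarrow> holo_germ g \<Longrightarrow> holo_germ (apply_vf a g)"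
  unfolding apply_vf_def vector_field_def
  by (intro holo_germ_sum holo_germ_mult holo_germ_frechet_derivative) (auto simp: norm_axis_1)

section \<open>Germ inclusion and vanishing ideals\<close>

text \<open>A preorder on representatives whose associated equivalence is \<open>germ_eq\<close>;
  maximality of a member of the families refers to it.\<close>

definition germ_le :: "(complex^'n) set \<Rightarrow> (complex^'n) set \<Rightarrow> bool" where
  "germ_le A B \<longleftrightarrow> (\<forall>\<^sub>F z in nhds 0. z \<in> A \<longrightarrow> z \<in> B)"

lemma germ_eq_iff_germ_le: "germ_eq A B \<longleftrightarrow> germ_le A B \<and> germ_le B A"
  by (auto simp: germ_eq_def germ_le_def eventually_conj_iff[symmetric] iff_conv_conj_imp)

lemma germ_le_trans: "germ_le A B \<Longrightarrow> germ_le B C \<Longrightarrow> germ_le A C"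
  unfolding germ_le_def by (auto elim: eventually_elim2)

lemma germ_eq_sym: "germ_eq A B \<Longrightarrow> germ_eq B A"
  by (simp add: germ_eq_iff_germ_le)

lemma vanishing_ideal_antimono: "germ_le A B \<Longrightarrow> vanishing_ideal B \<subseteq> vanishing_ideal A"
  unfolding germ_le_def vanishing_ideal_def by (auto elim: eventually_elim2)

text \<open>Allows a member of one family to be replaced by its partner, which may be a different
  representative of the same germ.\<close>

lemma logder_germ_eq: "germ_eq A B \<Longrightarrow> logder A = logder B"
  using vanishing_ideal_antimono[of A B] vanishing_ideal_antimono[of B A]
  by (simp add: logder_def germ_eq_iff_germ_le)

lemma vanishing_ideal_mult:
  assumes "f \<in> vanishing_ideal X" "holo_germ g"
  shows "(\<lambda>z. f z * g z) \<in> vanishing_ideal X" "(\<lambda>z. g z * f z) \<in> vanishing_ideal X"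
  using assms by (auto simp: vanishing_ideal_def intro: holo_germ_mult elim: eventually_mono)

text \<open>If the product vanishes on \<open>X\<close>, then \<open>X\<close> is the union of the
  analytic subgerms cut out by \<open>f\<close> and by \<open>g\<close>, and irreducibility makes
  one of them all of \<open>X\<close>.\<close>

lemma irreducible_germ_prime:
  assumes X: "irreducible_germ X" and fg: "holo_germ f" "holo_germ g"
    and "(\<lambda>z. f z * g z) \<in> vanishing_ideal X"
  shows "f \<in> vanishing_ideal X \<or> g \<in> vanishing_ideal X"
proof -
  have cut: "analytic_germ (X \<inter> {z. h z = 0})" if "holo_germ h" for h
  proof -
    obtain F where "finite F" "\<forall>f\<in>F. holo_germ f" "\<forall>\<^sub>F z in nhds 0. z \<in> X \<longleftrightarrow> (\<forall>f\<in>F. f z = 0)"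
      using X unfolding irreducible_germ_def analytic_germ_def by blast
    then show ?thesis
      unfolding analytic_germ_def using that
      by (intro exI[of _ "insert h F"]) (auto elim: eventually_mono)
  qed
  have "germ_eq X ((X \<inter> {z. f z = 0}) \<union> (X \<inter> {z. g z = 0}))"
    using assms(4) unfolding germ_eq_def vanishing_ideal_def by (auto elim: eventually_mono)
  then have "germ_eq X (X \<inter> {z. f z = 0}) \<or> germ_eq X (X \<inter> {z. g z = 0})"
    using X cut fg unfolding irreducible_germ_def by blast
  moreover have "h \<in> vanishing_ideal X" if "holo_germ h" "germ_eq X (X \<inter> {z. h z = 0})" for h
    using that unfolding germ_eq_def vanishing_ideal_def by (auto elim: eventually_mono)
  ultimately show ?thesis using fg by blast
qed

lemma irreducible_germ_one_notin:
  assumes "irreducible_germ X"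
  shows "(\<lambda>_. 1) \<notin> vanishing_ideal X"
  using assms by (auto simp: irreducible_germ_def germ_eq_def vanishing_ideal_def)

text \<open>One of the finitely many equations of \<open>X\<close> must fail on \<open>Z\<close>: if
  all held on \<open>Z\<close>, each near 0, they would hold on a common neighbourhood and put
  \<open>Z\<close> inside \<open>X\<close>.\<close>

lemma vanishing_ideal_separates:
  assumes "analytic_germ X" "\<not> germ_le Z X"
  obtains f where "f \<in> vanishing_ideal X" "f \<notin> vanishing_ideal Z"
proof -
  obtain F where F: "finite F" "\<forall>f\<in>F. holo_germ f" "\<forall>\<^sub>F z in nhds 0. z \<in> X \<longleftrightarrow> (\<forall>f\<in>F. f z = 0)"
    using assms(1) unfolding analytic_germ_def by blast
  have "F \<subseteq> vanishing_ideal X"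
    using F(2,3) by (auto simp: vanishing_ideal_def elim: eventually_mono)
  moreover have "\<not> F \<subseteq> vanishing_ideal Z"
  proof
    assume "F \<subseteq> vanishing_ideal Z"
    then have "\<forall>\<^sub>F z in nhds 0. \<forall>f\<in>F. z \<in> Z \<longrightarrow> f z = 0"
      using F(1) by (intro eventually_ball_finite) (auto simp: vanishing_ideal_def)
    with F(3) have "germ_le Z X"
      unfolding germ_le_def by eventually_elim auto
    with assms(2) show False ..
  qed
  ultimately show ?thesis using that by blast
qed

text \<open>Multiply one separating function for each member of \<open>A\<close>; primality keeps
  the product outside the ideal of \<open>Z\<close>. The empty product 1 is outside because
  \<open>Z\<close> is not the empty germ.\<close>

lemma common_multiplier:
  assumes Z: "irreducible_germ Z" and "finite A"
    and "\<And>X. X \<in> A \<Longrightarrow> analytic_germ X" "\<And>X. X \<in> A \<Longrightarrow> \<not> germ_le Z X"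
  shows "\<exists>f. holo_germ f \<and> f \<notin> vanishing_ideal Z \<and> (\<forall>X\<in>A. f \<in> vanishing_ideal X)"
  using assms(2-)
proof (induction A rule: finite_induct)
  case empty
  then show ?case using irreducible_germ_one_notin[OF Z] holo_germ_const by blast
next
  case (insert X A)
  then obtain f where f: "holo_germ f" "f \<notin> vanishing_ideal Z" "\<forall>X\<in>A. f \<in> vanishing_ideal X"
    by auto
  obtain g where g: "g \<in> vanishing_ideal X" "g \<notin> vanishing_ideal Z"
    using vanishing_ideal_separates[of X Z] insert.prems by auto
  have hg: "holo_germ g" using g(1) by (simp add: vanishing_ideal_def)
  show ?case
  proof (intro exI conjI ballI)
    show "holo_germ (\<lambda>z. g z * f z)" by (intro holo_germ_mult hg f)
    show "(\<lambda>z. g z * f z) \<notin> vanishing_ideal Z"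
      using irreducible_germ_prime[OF Z hg f(1)] f(2) g(2) by blast
    show "(\<lambda>z. g z * f z) \<in> vanishing_ideal Y" if "Y \<in> insert X A" for Y
      using that f(1,3) g(1) hg by (auto intro: vanishing_ideal_mult)
  qed
qed

section \<open>Multiplying vector fields by functions\<close>

lemma apply_vf_scale: "apply_vf (\<lambda>i z. f z * a i z) g = (\<lambda>z. f z * apply_vf a g z)"
  by (simp add: apply_vf_def sum_distrib_left mult.assoc)

lemma vector_field_scale: "holo_germ f \<Longrightarrow> vector_field a \<Longrightarrow> vector_field (\<lambda>i z. f z * a i z)"
  by (simp add: vector_field_def holo_germ_mult)

lemma logder_scale:
  assumes "a \<in> logder X" "holo_germ f"
  shows "(\<lambda>i z. f z * a i z) \<in> logder X"
  using assms by (simp add: logder_def apply_vf_scale vector_field_scale vanishing_ideal_mult(2))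

text \<open>The scaled field sends \<open>g\<close> to \<open>f\<close> times a holomorphic germ,
  which vanishes on \<open>X\<close> because \<open>f\<close> does, whatever \<open>a\<close>
  is.\<close>

lemma logder_scale_vanishing:
  assumes "f \<in> vanishing_ideal X" "vector_field a"
  shows "(\<lambda>i z. f z * a i z) \<in> logder X"
proof -
  have "holo_germ f" using assms by (simp add: vanishing_ideal_def)
  moreover have "holo_germ g" if "g \<in> vanishing_ideal X" for g
    using that by (simp add: vanishing_ideal_def)
  ultimately show ?thesis
    using assms
    by (simp add: logder_def apply_vf_scale vector_field_scale vanishing_ideal_mult(1) holo_germ_apply_vf)
qed

text \<open>The product of \<open>f\<close> and \<open>apply_vf a g\<close> lies in a prime ideal
  that does not contain \<open>f\<close>.\<close>

lemma logder_cancel: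
  assumes Z: "irreducible_germ Z" and f: "holo_germ f" "f \<notin> vanishing_ideal Z"
    and a: "vector_field a" "(\<lambda>i z. f z * a i z) \<in> logder Z"
  shows "a \<in> logder Z"
proof -
  have "apply_vf a g \<in> vanishing_ideal Z" if g: "g \<in> vanishing_ideal Z" for g
  proof -
    have "holo_germ (apply_vf a g)"
      using g a(1) by (intro holo_germ_apply_vf) (auto simp: vanishing_ideal_def)
    moreover have "(\<lambda>z. f z * apply_vf a g z) \<in> vanishing_ideal Z"
      using a(2) g by (auto simp: logder_def apply_vf_scale)
    ultimately show ?thesis using irreducible_germ_prime[OF Z f(1)] f(2) by blast
  qed
  then show ?thesis using a(1) by (simp add: logder_def)
qed

section \<open>Comparing the two families\<close>

text \<open>The ascent step: an unmatched member of one family lies below an unmatched member of the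
  other. Otherwise every \<open>X\<close> above \<open>Z\<close> has a partner in
  \<open>YY - {Z}\<close>, every other \<open>X\<close> is handled by the multiplier
  \<open>f\<close>, and \<open>Z\<close> becomes redundant.\<close>

lemma irredundant_has_unmatched_above:
  fixes XX YY :: "(complex^'n::finite) set set"
  assumes fin: "finite XX" and XX: "\<forall>X\<in>XX. irreducible_germ X" and Z: "irreducible_germ Z"
    and irr: "irredundant YY" and eq: "logder_fam XX = logder_fam YY"
    and ZY: "Z \<in> YY" and no: "\<not> (\<exists>X\<in>XX. germ_eq Z X)"
  shows "\<exists>X\<in>XX. germ_le Z X \<and> \<not> (\<exists>Y\<in>YY. germ_eq X Y)"
proof (rule ccontr)
  assume contra: "\<not> ?thesis"
  have "\<exists>f. holo_germ f \<and> f \<notin> vanishing_ideal Z \<and>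
      (\<forall>X\<in>{X\<in>XX. \<not> germ_le Z X}. f \<in> vanishing_ideal X)"
    by (rule common_multiplier[OF Z]) (use fin XX in \<open>simp_all add: irreducible_germ_def\<close>)
  then obtain f where f: "holo_germ f" "f \<notin> vanishing_ideal Z"
    "\<forall>X\<in>{X\<in>XX. \<not> germ_le Z X}. f \<in> vanishing_ideal X" by blast
  have "a \<in> logder Z" if a: "a \<in> logder_fam (YY - {Z})" for a
  proof -
    have vf: "vector_field a" using a by (simp add: logder_fam_def)
    have "(\<lambda>i z. f z * a i z) \<in> logder X" if X: "X \<in> XX" for X
    proof (cases "germ_le Z X")
      case True
      then obtain Y where Y: "Y \<in> YY" "germ_eq X Y" using contra X by blast
      \<comment> \<open>If the partner were \<open>Z\<close>, then \<open>X\<close> would match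
        \<open>Z\<close>. So \<open>Y\<close> survives the removal of \<open>Z\<close>, and
        \<open>a\<close> preserves its ideal.\<close>
      then have "Y \<noteq> Z" using no X germ_eq_sym by blast
      then have "a \<in> logder X"
        using a Y logder_germ_eq by (auto simp: logder_fam_def)
      then show ?thesis by (rule logder_scale[OF _ f(1)])
    next
      case False
      then show ?thesis using f(3) X vf by (simp add: logder_scale_vanishing)
    qed
    then have "(\<lambda>i z. f z * a i z) \<in> logder_fam YY"
      unfolding eq[symmetric] using vector_field_scale[OF f(1) vf] by (simp add: logder_fam_def)
    then show ?thesis
      using ZY logder_cancel[OF Z f(1,2) vf] by (simp add: logder_fam_def)
  qed
  then have "logder_fam (YY - {Z}) = logder_fam YY"
    by (auto simp: logder_fam_def)
  then show False using irr ZY by (auto simp: irredundant_def)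
qed

theorem theorem1:
  fixes XX YY :: "(complex^'n::finite) set set"
  assumes "finite XX" and "finite YY"
    and "\<forall>X\<in>XX. irreducible_germ X" and "\<forall>Y\<in>YY. irreducible_germ Y"
    and "irredundant XX" and "irredundant YY"
    and "logder_fam XX = logder_fam YY"
  shows "(\<forall>X\<in>XX. \<exists>Y\<in>YY. germ_eq X Y) \<and> (\<forall>Y\<in>YY. \<exists>X\<in>XX. germ_eq X Y)"
proof (rule ccontr)
  assume neg: "\<not> ?thesis"
  define S where "S = {X\<in>XX. \<not> (\<exists>Y\<in>YY. germ_eq X Y)} \<union> {Y\<in>YY. \<not> (\<exists>X\<in>XX. germ_eq Y X)}"
  \<comment> \<open>The ascent is strict: \<open>W\<close> comes from the other family, so inclusion
    in both directions would make it a partner of \<open>Z\<close>.\<close>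
  have step: "\<exists>W\<in>S. germ_le Z W \<and> \<not> germ_le W Z" if "Z \<in> S" for Z
  proof -
    consider "Z \<in> XX" "\<not> (\<exists>Y\<in>YY. germ_eq Z Y)" | "Z \<in> YY" "\<not> (\<exists>X\<in>XX. germ_eq Z X)"
      using \<open>Z \<in> S\<close> by (auto simp: S_def)
    then show ?thesis
    proof cases
      case 1
      then obtain W where "W \<in> YY" "germ_le Z W" "\<not> (\<exists>X\<in>XX. germ_eq W X)"
        using irredundant_has_unmatched_above[of YY Z XX] assms by auto
      with 1 show ?thesis by (auto simp: S_def germ_eq_iff_germ_le)
    next
      case 2
      then obtain W where "W \<in> XX" "germ_le Z W" "\<not> (\<exists>Y\<in>YY. germ_eq W Y)"
        using irredundant_has_unmatched_above[of XX Z YY] assms by auto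
      with 2 show ?thesis by (auto simp: S_def germ_eq_iff_germ_le)
    qed
  qed
  have "finite S" "S \<noteq> {}"
    using neg assms(1,2) germ_eq_sym unfolding S_def by (auto, blast+)
  moreover have "asymp_on S (\<lambda>A B. germ_le A B \<and> \<not> germ_le B A)"
    by (simp add: asymp_on_def)
  moreover have "transp_on S (\<lambda>A B. germ_le A B \<and> \<not> germ_le B A)"
    unfolding transp_on_def by (metis germ_le_trans)
  \<comment> \<open>A strict order on a finite nonempty set has a maximal element, which
    \<open>step\<close> contradicts.\<close>
  ultimately have "\<exists>Z\<in>S. \<forall>W\<in>S. W \<noteq> Z \<longrightarrow> \<not> (germ_le Z W \<and> \<not> germ_le W Z)"
    by (intro Finite_Set.bex_max_element)
  with step show False by metis
qed

end
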